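(* Let $I \subseteq \mathbb{R}$ be an interval with interior $I^{\circ}$, let $f: I \to \mathbb{R}$ be four times differentiable on $I^{\circ}$, let $a,b \in I^{\circ}$ with $a<b$, and suppose $f^{(iv)} \in L[a,b]$. If $|f^{(iv)}|$ is quasi-convex on $[a,b]$, then $$\left| \frac{f(a)+f(b)}{2} - \frac{1}{b-a}\int_a^b f(x)\,dx - \frac{b-a}{12}\,[f'(b)-f'(a)] \right| \le \frac{(b-a)^4}{720}\max\{|f^{(iv)}(a)|,|f^{(iv)}(b)|\}.$$
   Context: A function $g:[a,b]\to\mathbb{R}$ is called quasi-convex on $[a,b]$ if $g(\lambda x+(1-\lambda)y)\le \max\{g(x),g(y)\}$ for all $x,y\in[a,b]$ and all $\lambda\in[0,1]$. $f^{(iv)}$ denotes the fourth derivative of $f$, and $L[a,b]$ denotes the Lebesgue integrable functions on $[a,b]$. *)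

theory Defs
  imports "HOL-Analysis.Analysis"
begin

(* As in convex_on, the domain is required to be convex; this is automatic for [a,b]. *)
definition quasi_convex_on :: "'a::real_vector set \<Rightarrow> ('a \<Rightarrow> real) \<Rightarrow> bool" where
  "quasi_convex_on S g \<longleftrightarrow> convex S \<and>
     (\<forall>x\<in>S. \<forall>y\<in>S. \<forall>t\<in>{0..1}. g (t *\<^sub>R x + (1 - t) *\<^sub>R y) \<le> max (g x) (g y))"

(* (deriv ^^ n) f is the n-th derivative. S is meant to be open: then the values of f
   outside S have no influence, either here or on (deriv ^^ n) f at points of S. *)
definition times_differentiable_on :: "nat \<Rightarrow> (real \<Rightarrow> real) \<Rightarrow> real set \<Rightarrow> bool" where
  "times_differentiable_on n f S \<longleftrightarrow> (\<forall>k<n. \<forall>x\<in>S. (deriv ^^ k) f differentiable at x)"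

end

theory Submission
  imports Defs
begin

text \<open>
  Integrating the fourth derivative of f four times by parts against the kernel
  (x - a)^2 (x - b)^2, which vanishes to second order at both end points, produces
  -24 (b - a) times the error to be estimated. The kernel is nonnegative with integral
  (b - a)^5 / 30, and a quasi-convex function on [a, b] is bounded by its larger end point value.
\<close>

lemma quasi_convex_on_le_max_endpoints:
  fixes g :: "real \<Rightarrow> real"
  assumes "quasi_convex_on {a..b} g" "x \<in> {a..b}"
  shows "g x \<le> max (g a) (g b)"
proof -
  have "x \<in> closed_segment a b"
    using assms(2) by (auto simp: closed_segment_eq_real_ivl)
  then obtain t where t: "0 \<le> t" "t \<le> 1" "x = (1 - t) *\<^sub>R a + t *\<^sub>R b"
    by (auto simp: in_segment)
  have "\<forall>u\<in>{a..b}. \<forall>v\<in>{a..b}. \<forall>t\<in>{0..1}.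
      g (t *\<^sub>R u + (1 - t) *\<^sub>R v) \<le> max (g u) (g v)"
    using assms(1) by (simp add: quasi_convex_on_def)
  moreover have "a \<in> {a..b}" "b \<in> {a..b}" "t \<in> {0..1}"
    using assms(2) t by auto
  \<comment> \<open>In \<open>in_segment\<close> the weight t belongs to the second end point, in
    \<open>quasi_convex_on\<close> to the first, so the end points enter in the order b, a.\<close>
  ultimately have "g (t *\<^sub>R b + (1 - t) *\<^sub>R a) \<le> max (g b) (g a)"
    by blast
  then show ?thesis
    using t(3) by (simp add: add.commute max.commute)
qed

lemma times_differentiable_on_imp_DERIV:
  assumes "times_differentiable_on n f S" "k < n" "x \<in> S"
  shows "((deriv ^^ k) f has_real_derivative (deriv ^^ Suc k) f x) (at x)"
  using assms DERIV_deriv_iff_real_differentiable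
  by (auto simp: times_differentiable_on_def)

lemma has_integral_quartic_kernel:
  fixes a b :: real
  assumes "a \<le> b"
  shows "((\<lambda>x. (x - a)^2 * (x - b)^2) has_integral (b - a)^5 / 30) {a..b}"
proof -
  \<comment> \<open>Substituting x - b = (x - a) - (b - a) turns the kernel into a polynomial in x -
    a, integrated here term by term. At b the coefficients add up to 1/5 - 1/2 + 1/3 = 1/30.\<close>
  let ?P = "\<lambda>x. (x - a)^5 / 5 - (b - a) * (x - a)^4 / 2 + (b - a)^2 * (x - a)^3 / 3"
  have "(?P has_real_derivative (x - a)^2 * (x - b)^2) (at x within {a..b})" for x
    by (rule derivative_eq_intros refl | simp)+ algebra
  then have "((\<lambda>x. (x - a)^2 * (x - b)^2) has_integral ?P b - ?P a) {a..b}"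
    using assms
    by (intro fundamental_theorem_of_calculus)
       (auto simp: has_real_derivative_iff_has_vector_derivative)
  moreover have "?P b - ?P a = (b - a)^5 / 30"
    by (simp add: field_simps eval_nat_numeral)
  ultimately show ?thesis by simp
qed

text \<open>All integrations by parts are merged into one use of the fundamental theorem of calculus
  for the gauge integral. It asks only for a derivative at each point, so \<open>f4\<close> may be
  discontinuous and the existence of its weighted integral is part of the result.\<close>

lemma has_integral_quartic_kernel_times_fourth_deriv:
  fixes f0 f1 f2 f3 f4 :: "real \<Rightarrow> real"
  assumes "a \<le> b"
    and d0: "\<And>x. x \<in> {a..b} \<Longrightarrow> (f0 has_real_derivative f1 x) (at x within {a..b})"
    and d1: "\<And>x. x \<in> {a..b} \<Longrightarrow> (f1 has_real_derivative f2 x) (at x within {a..b})"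
    and d2: "\<And>x. x \<in> {a..b} \<Longrightarrow> (f2 has_real_derivative f3 x) (at x within {a..b})"
    and d3: "\<And>x. x \<in> {a..b} \<Longrightarrow> (f3 has_real_derivative f4 x) (at x within {a..b})"
  shows "((\<lambda>x. (x - a)^2 * (x - b)^2 * f4 x) has_integral
      2 * (b - a)^2 * (f1 b - f1 a) - 12 * (b - a) * (f0 a + f0 b) + 24 * integral {a..b} f0) {a..b}"
proof -
  \<comment> \<open>With K the kernel, this is K f3 - K' f2 + K'' f1 - K''' f0. Its derivative
    telescopes to K f4 - K'''' f0, and K'''' = 24.\<close>
  let ?F = "\<lambda>x. (x - a)^2 * (x - b)^2 * f3 x - 2 * (x - a) * (x - b) * (2 * x - a - b) * f2 x
    + (2 * (x - a)^2 + 8 * (x - a) * (x - b) + 2 * (x - b)^2) * f1 x - 12 * (2 * x - a - b) * f0 x"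
  have "(?F has_real_derivative (x - a)^2 * (x - b)^2 * f4 x - 24 * f0 x) (at x within {a..b})"
    if x: "x \<in> {a..b}" for x
    by (rule derivative_eq_intros refl d0[OF x] d1[OF x] d2[OF x] d3[OF x] | simp)+ algebra
  then have "((\<lambda>x. (x - a)^2 * (x - b)^2 * f4 x - 24 * f0 x) has_integral ?F b - ?F a) {a..b}"
    using assms(1)
    by (intro fundamental_theorem_of_calculus)
       (auto simp: has_real_derivative_iff_has_vector_derivative)
  moreover have "continuous_on {a..b} f0"
    using d0 by (rule DERIV_continuous_on)
  then have "((\<lambda>x. 24 * f0 x) has_integral 24 * integral {a..b} f0) {a..b}"
    by (intro has_integral_mult_right integrable_integral integrable_continuous_real)
  ultimately have "((\<lambda>x. (x - a)^2 * (x - b)^2 * f4 x - 24 * f0 x + 24 * f0 x) has_integral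
      ?F b - ?F a + 24 * integral {a..b} f0) {a..b}"
    by (rule has_integral_add)
  \<comment> \<open>K and K' vanish at both end points, K'' equals 2 (b - a)^2 at both, and K'''
    equals -12 (b - a) at a and 12 (b - a) at b; hence the difference of the \<open>f1\<close>
    values but the sum of the \<open>f0\<close> values.\<close>
  moreover have "?F b - ?F a = 2 * (b - a)^2 * (f1 b - f1 a) - 12 * (b - a) * (f0 a + f0 b)"
    by (simp add: algebra_simps power2_commute[of a b])
  ultimately show ?thesis by simp
qed

theorem theorem2p2:
  fixes I :: "real set" and f :: "real \<Rightarrow> real" and a b :: real
  assumes "is_interval I"
    and "times_differentiable_on 4 f (interior I)"
    and "a \<in> interior I" and "b \<in> interior I" and "a < b"
    and "set_integrable lebesgue {a..b} ((deriv ^^ 4) f)"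
    and "quasi_convex_on {a..b} (\<lambda>x. \<bar>(deriv ^^ 4) f x\<bar>)"
  shows "\<bar>(f a + f b) / 2 - 1 / (b - a) * integral {a..b} f
            - (b - a) / 12 * (deriv f b - deriv f a)\<bar>
         \<le> (b - a) ^ 4 / 720 * max \<bar>(deriv ^^ 4) f a\<bar> \<bar>(deriv ^^ 4) f b\<bar>"
proof -
  let ?f4 = "(deriv ^^ 4) f"
  define M where "M = max \<bar>?f4 a\<bar> \<bar>?f4 b\<bar>"
  define E where "E = (f a + f b) / 2 - 1 / (b - a) * integral {a..b} f
    - (b - a) / 12 * (deriv f b - deriv f a)"
  let ?J = "2 * (b - a)^2 * (deriv f b - deriv f a) - 12 * (b - a) * (f a + f b)
    + 24 * integral {a..b} f"
  have "is_interval (interior I)"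
    using assms(1) by (simp add: is_interval_convex_1 convex_interior)
  \<comment> \<open>Derivatives are known only on the interior, which is again an interval and so
    contains all points between a and b.\<close>
  then have sub: "x \<in> interior I" if "x \<in> {a..b}" for x
    using assms(3,4) that by (auto intro: mem_is_interval_1_I)
  have deriv_k: "((deriv ^^ k) f has_real_derivative (deriv ^^ Suc k) f x) (at x within {a..b})"
    if "k < 4" "x \<in> {a..b}" for k x
    using times_differentiable_on_imp_DERIV[OF assms(2) that(1) sub[OF that(2)]]
    by (rule DERIV_subset) simp
  have J: "((\<lambda>x. (x - a)^2 * (x - b)^2 * ?f4 x) has_integral ?J) {a..b}"
    using has_integral_quartic_kernel_times_fourth_deriv
      [of a b "(deriv ^^ 0) f" "(deriv ^^ 1) f" "(deriv ^^ 2) f" "(deriv ^^ 3) f" ?f4]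
      deriv_k[of 0] deriv_k[of 1] deriv_k[of 2] deriv_k[of 3] assms(5)
    by (simp add: eval_nat_numeral)
  have K: "((\<lambda>x. (x - a)^2 * (x - b)^2 * M) has_integral (b - a)^5 / 30 * M) {a..b}"
    using has_integral_quartic_kernel[of a b] assms(5) by (intro has_integral_mult_left) simp
  \<comment> \<open>The kernel is a product of squares, so it keeps its sign under the absolute
    value and preserves the bound by M.\<close>
  have "norm ((x - a)^2 * (x - b)^2 * ?f4 x) \<le> (x - a)^2 * (x - b)^2 * M" if "x \<in> {a..b}" for x
    using quasi_convex_on_le_max_endpoints[OF assms(7) that]
    by (auto simp: abs_mult M_def intro!: mult_left_mono)
  then have "norm ?J \<le> (b - a)^5 / 30 * M"
    using integral_norm_bound_integral[OF has_integral_integrable[OF J] has_integral_integrable[OF K]]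
    unfolding integral_unique[OF J] integral_unique[OF K] by blast
  moreover have "?J = - (24 * (b - a)) * E"
    using assms(5) by (simp add: E_def field_simps power2_eq_square)
  moreover have "\<bar>- (24 * (b - a)) * E\<bar> = 24 * (b - a) * \<bar>E\<bar>"
    using assms(5) by (simp only: abs_mult abs_minus_cancel)
  \<comment> \<open>Here 720 = 24 * 30: one factor b - a is split off to match the factor 24 (b - a)
    in front of E.\<close>
  moreover have "(b - a)^5 / 30 * M = 24 * (b - a) * ((b - a)^4 / 720 * M)"
    by (simp add: eval_nat_numeral)
  ultimately have "24 * (b - a) * \<bar>E\<bar> \<le> 24 * (b - a) * ((b - a)^4 / 720 * M)"
    by (simp only: real_norm_def)
  then have "\<bar>E\<bar> \<le> (b - a)^4 / 720 * M"
    using assms(5) by (subst (asm) mult_le_cancel_left_pos) auto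
  then show ?thesis
    by (simp add: E_def M_def)
qed

end
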